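(* Let $(b,\beta,\sigma,K)$ be admissible parameters, and suppose that $E_\beta\in L^1(\mathbb{R}_+;\mathbb{R}^{m\times m})$. Then: (a) If $\int_0^\infty R_\beta(t)dt=I_m$, then $K\beta$ is not integrable on $\mathbb{R}_+$. (b) If $\beta^\top\beta$ has only strictly positive eigenvalues and the function $K_*(t)=\min_{j=1,\dots,m}K_j(t)$ is not integrable over $\mathbb{R}_+$, then $\int_0^\infty R_\beta(t)dt=I_m$.
   Context: Fix $m\in\mathbb{N}$, $\mathbb{R}_+=[0,\infty)$; $I_m$ is the $m\times m$ identity matrix. Admissible parameters: $(b,\beta,\sigma,K)$ is admissible if (i) $b\in\mathbb{R}_+^m$; (ii) $\beta=(\beta_{ij})\in\mathbb{R}^{m\times m}$ with $\beta_{ij}\ge0$ for $i\ne j$; (iii) $\sigma=(\sigma_1,\dots,\sigma_m)^\top\in\mathbb{R}_+^m$; (iv) $K=\mathrm{diag}(K_1,\dots,K_m)$ with scalar kernels $K_i\in L^2_{loc}(\mathbb{R}_+,\mathbb{R})$; (v) there are $\gamma\in(0,2]$, $C_1>0$ with $\int_0^h|K_i(r)|^2dr\le C_1h^\gamma$ for $h\in[0,1]$ and all $i$, and for each $T>0$ there is $C_2(T)>0$ with $\int_0^T|K_i(r+h)-K_i(r)|^2dr\le C_2(T)h^\gamma$ for $h\in[0,1]$ and all $i$; (vi) for each $i$ and $h\in[0,1]$ the shifted kernel $t\mapsto K_i(t+h)$ is nonnegative, not identically zero, nonincreasing and continuous on $(0,\infty)$, and its resolvent of the first kind $L$ (the measure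 of locally bounded variation on $\mathbb{R}_+$ whose convolution with the shifted kernel equals $1$) is nonnegative and $s\mapsto L([s,s+t])$ is nonincreasing for all $t\ge0$. Resolvents: $f*g(t)=\int_0^tf(t-s)g(s)ds$; with $K_\beta(t)=-K(t)\beta$, $R_\beta\in L^1_{loc}(\mathbb{R}_+;\mathbb{R}^{m\times m})$ is defined by $R_\beta*K_\beta=K_\beta*R_\beta=K_\beta-R_\beta$, and $E_\beta=K-R_\beta*K$. (One has $R_\beta=E_\beta(-\beta)$, so $R_\beta$ is integrable when $E_\beta$ is.) *)

theory Defs
  imports "HOL-Analysis.Analysis"
begin

text \<open>
  The half-line is the set \<open>{0..}\<close> of reals; values of kernels at negative arguments are never
  used. Elements of $L^p$-spaces are represented by Borel functions, and identities between
  them are required almost everywhere. Vectors and matrices are indexed by a finite type \<open>'m\<close>,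
  with \<open>CARD('m)\<close> in the role of $m$.
\<close>

definition L1_loc :: "(real \<Rightarrow> 'a::{banach, second_countable_topology}) \<Rightarrow> bool" where
  "L1_loc f \<longleftrightarrow> (\<forall>T. set_integrable lborel {0..T} f)"

definition L2_loc :: "(real \<Rightarrow> real) \<Rightarrow> bool" where
  "L2_loc f \<longleftrightarrow> set_borel_measurable lborel {0..} f \<and>
     (\<forall>T. set_integrable lborel {0..T} (\<lambda>r. \<bar>f r\<bar>\<^sup>2))"

text \<open>
  A measure of locally bounded variation on the half-line is signed and in general only defined
  on bounded Borel sets. It is represented as a difference \<open>P - N\<close> of two locally finite
  (nonnegative) Borel measures on \<open>{0..}\<close>, as in the Jordan decomposition; \<open>P\<close> and \<open>N\<close> are not
  required to be mutually singular.
\<close>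

definition loc_finite_measure :: "real measure \<Rightarrow> bool" where
  "loc_finite_measure M \<longleftrightarrow>
     sets M = sets (restrict_space borel {0..}) \<and> (\<forall>T. emeasure M {0..T} < \<infinity>)"

definition first_kind_resolvent :: "(real \<Rightarrow> real) \<Rightarrow> real measure \<Rightarrow> real measure \<Rightarrow> bool" where
  "first_kind_resolvent k P N \<longleftrightarrow> loc_finite_measure P \<and> loc_finite_measure N \<and>
     (AE t in lborel. 0 \<le> t \<longrightarrow>
        set_integrable P {0..t} (\<lambda>s. k (t - s)) \<and> set_integrable N {0..t} (\<lambda>s. k (t - s)) \<and>
        (LINT s:{0..t}|P. k (t - s)) - (LINT s:{0..t}|N. k (t - s)) = 1)"

text \<open>
  The resolvent of the first kind is unique, so the existential quantifier speaks about the
  resolvent; its last two conjuncts say that it is nonnegative on bounded Borel sets and that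
  its mass on \<open>{s..s + t}\<close> is nonincreasing in \<open>s\<close>.
\<close>

definition regular_kernel :: "(real \<Rightarrow> real) \<Rightarrow> bool" where
  "regular_kernel k \<longleftrightarrow>
     (\<forall>t>0. 0 \<le> k t) \<and> (\<exists>t>0. k t \<noteq> 0) \<and>
     antimono_on {0<..} k \<and> continuous_on {0<..} k \<and>
     (\<exists>P N. first_kind_resolvent k P N \<and>
        (\<forall>A\<in>sets borel. bounded A \<and> A \<subseteq> {0..} \<longrightarrow> 0 \<le> measure P A - measure N A) \<and>
        (\<forall>t\<ge>0. antimono_on {0..} (\<lambda>s. measure P {s..s + t} - measure N {s..s + t})))"

definition admissible ::
    "real^'m \<Rightarrow> real^'m^'m \<Rightarrow> real^'m \<Rightarrow> ('m::finite \<Rightarrow> real \<Rightarrow> real) \<Rightarrow> bool" where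
  "admissible b \<beta> \<sigma> K \<longleftrightarrow>
     (\<forall>i. 0 \<le> b $ i) \<and>
     (\<forall>i j. i \<noteq> j \<longrightarrow> 0 \<le> \<beta> $ i $ j) \<and>
     (\<forall>i. 0 \<le> \<sigma> $ i) \<and>
     (\<forall>i. L2_loc (K i)) \<and>
     (\<exists>\<gamma> C1. 0 < \<gamma> \<and> \<gamma> \<le> 2 \<and> 0 < C1 \<and>
        (\<forall>i. \<forall>h\<in>{0..1}. (LINT r:{0..h}|lborel. \<bar>K i r\<bar>\<^sup>2) \<le> C1 * h powr \<gamma>) \<and>
        (\<forall>T>0. \<exists>C2>0. \<forall>i. \<forall>h\<in>{0..1}.
           (LINT r:{0..T}|lborel. \<bar>K i (r + h) - K i r\<bar>\<^sup>2) \<le> C2 * h powr \<gamma>)) \<and>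
     (\<forall>i. \<forall>h\<in>{0..1}. regular_kernel (\<lambda>t. K i (t + h)))"

definition diag_kernel :: "('m::finite \<Rightarrow> real \<Rightarrow> real) \<Rightarrow> real \<Rightarrow> real^'m^'m" where
  "diag_kernel K t = (\<chi> i j. if i = j then K i t else 0)"

definition conv ::
    "(real \<Rightarrow> real^'m^'m) \<Rightarrow> (real \<Rightarrow> real^'m^'m) \<Rightarrow> real \<Rightarrow> real^'m^('m::finite)" where
  "conv f g t = (LINT s:{0..t}|lborel. f (t - s) ** g s)"

definition K_beta :: "('m::finite \<Rightarrow> real \<Rightarrow> real) \<Rightarrow> real^'m^'m \<Rightarrow> real \<Rightarrow> real^'m^'m" where
  "K_beta K \<beta> t = - (diag_kernel K t ** \<beta>)"

text \<open>The resolvent is determined by this property up to equality almost everywhere.\<close>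

definition is_R_beta ::
    "('m::finite \<Rightarrow> real \<Rightarrow> real) \<Rightarrow> real^'m^'m \<Rightarrow> (real \<Rightarrow> real^'m^'m) \<Rightarrow> bool" where
  "is_R_beta K \<beta> R \<longleftrightarrow> L1_loc R \<and>
     (AE t in lborel. 0 \<le> t \<longrightarrow> conv R (K_beta K \<beta>) t = K_beta K \<beta> t - R t) \<and>
     (AE t in lborel. 0 \<le> t \<longrightarrow> conv (K_beta K \<beta>) R t = K_beta K \<beta> t - R t)"

definition E_beta ::
    "('m::finite \<Rightarrow> real \<Rightarrow> real) \<Rightarrow> (real \<Rightarrow> real^'m^'m) \<Rightarrow> real \<Rightarrow> real^'m^'m" where
  "E_beta K R t = diag_kernel K t - conv R (diag_kernel K) t"

text \<open>Real eigenvalues; the notion is applied to symmetric matrices only.\<close>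

definition eigenvalue :: "real^'m^'m \<Rightarrow> real \<Rightarrow> bool" where
  "eigenvalue A l \<longleftrightarrow> (\<exists>v. v \<noteq> 0 \<and> A *v v = l *\<^sub>R v)"

end

theory Submission
  imports Defs
begin

text \<open>
  On integrable functions, integration over the half-line turns convolution into the matrix
  product (\<open>laplace_conv\<close> at exponent 0). This gives the first part at once: if \<open>K \<beta>\<close> were
  integrable, then integrating \<open>R * K\<^sub>\<beta> = K\<^sub>\<beta> - R\<close> with \<open>\<integral> R = I\<close> would yield
  \<open>\<integral> K\<^sub>\<beta> = \<integral> K\<^sub>\<beta> - I\<close>. Integrability of \<open>R\<close> is automatic there, because the Bochner integral
  of a function that is not integrable is 0.

  In the second part \<open>\<beta>\<close> is invertible, and \<open>R = - E\<^sub>\<beta> \<beta>\<close> almost everywhere inherits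
  integrability from \<open>E\<^sub>\<beta>\<close>. The kernels \<open>K\<^sub>j\<close> are not integrable, but the factor \<open>exp (- l t)\<close>
  with \<open>l > 0\<close> makes them so, and it is compatible with convolution. With \<open>L\<close> for the
  Laplace transform, the definition \<open>E\<^sub>\<beta> = K - R * K\<close> becomes, entry by entry,
  \<open>L E\<^sub>i\<^sub>j(l) = (I - L R(l))\<^sub>i\<^sub>j L K\<^sub>j(l)\<close>.
  As \<open>l\<close> decreases to 0, dominated convergence sends the left-hand side and \<open>L R(l)\<close> to the
  finite integrals of \<open>E\<^sub>\<beta>\<close> and \<open>R\<close>. If the entry \<open>(I - \<integral> R)\<^sub>i\<^sub>j\<close> were nonzero, one could divide by
  it and \<open>L K\<^sub>j(l)\<close> would converge; by monotone convergence \<open>K\<^sub>j\<close>, and with it the smaller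
  function \<open>min\<^sub>j K\<^sub>j\<close>, would then be integrable. Hence all entries of \<open>I - \<integral> R\<close> vanish.
\<close>

section \<open>Laplace transforms of half-line convolutions\<close>

text \<open>
  Fubini's theorem together with translation invariance. The norm of the integrand is dominated by
  a constant times \<open>norm (f (t - s)) * norm (g s)\<close>, whose integral over \<open>t\<close> no longer depends
  on the shift \<open>s\<close>.
\<close>

lemma
  fixes pr :: "'a::{banach, second_countable_topology} \<Rightarrow> 'b::{banach, second_countable_topology}
      \<Rightarrow> 'c::{banach, second_countable_topology}"
  assumes "bounded_bilinear pr"
    and f: "integrable lborel f" and g: "integrable lborel g"
  shows integrable_convolution: "integrable lborel (\<lambda>t::real. LINT s|lborel. pr (f (t - s)) (g s))"
    and integral_convolution:
      "(LINT t|lborel. LINT s|lborel. pr (f (t - s)) (g s))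
        = pr (integral\<^sup>L lborel f) (integral\<^sup>L lborel g)"
proof -
  interpret bounded_bilinear pr by fact
  obtain C where C: "0 \<le> C" "\<And>x y. norm (pr x y) \<le> norm x * norm y * C"
    using nonneg_bounded by blast
  have [measurable]: "f \<in> borel_measurable borel" "g \<in> borel_measurable borel"
    using f g by auto
  have [measurable]: "(\<lambda>(s, t). pr (f (t - s)) (g s)) \<in> borel_measurable (lborel \<Otimes>\<^sub>M lborel)"
  proof -
    have "continuous_on UNIV (\<lambda>(x, y). pr x y)"
      unfolding case_prod_beta by (intro continuous_on continuous_intros)
    from borel_measurable_continuous_on[OF this, of "\<lambda>(s, t). (f (t - s), g s)"]
    show ?thesis
      by (simp add: case_prod_beta)
  qed
  have shift: "integrable lborel (\<lambda>t. h (t - s))"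
      "(LINT t|lborel. h (t - s)) = integral\<^sup>L lborel h"
    if "integrable lborel h" for h :: "real \<Rightarrow> 'd::{banach, second_countable_topology}" and s
    using lborel_integrable_real_affine[OF that, of 1 "- s"]
      lborel_integral_real_affine[of 1 h "- s"] by simp_all
  have nf: "integrable lborel (\<lambda>t. norm (f t))" and ng: "integrable lborel (\<lambda>t. norm (g t))"
    using f g by auto
  have "integrable (lborel \<Otimes>\<^sub>M lborel) (\<lambda>(s, t). norm (f (t - s)) * norm (g s) * C)"
    using ng C(1) shift(1)[OF f] shift[OF nf]
    by (intro lborel_pair.Fubini_integrable) (auto simp: abs_mult)
  then have int: "integrable (lborel \<Otimes>\<^sub>M lborel) (\<lambda>(s, t). pr (f (t - s)) (g s))"
    by (rule Bochner_Integration.integrable_bound) (use C in \<open>auto simp: abs_mult intro!: AE_I2\<close>)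
  show "integrable lborel (\<lambda>t::real. LINT s|lborel. pr (f (t - s)) (g s))"
    using lborel_pair.integrable_snd[OF int] by simp
  have "(LINT t|lborel. LINT s|lborel. pr (f (t - s)) (g s))
      = (LINT s|lborel. LINT t|lborel. pr (f (t - s)) (g s))"
    using lborel_pair.Fubini_integral[OF int] by simp
  also have "\<dots> = (LINT s|lborel. pr (integral\<^sup>L lborel f) (g s))"
    by (simp add: shift f integral_bounded_linear[OF bounded_linear_left])
  also have "\<dots> = pr (integral\<^sup>L lborel f) (integral\<^sup>L lborel g)"
    by (rule integral_bounded_linear[OF bounded_linear_right g])
  finally show "(LINT t|lborel. LINT s|lborel. pr (f (t - s)) (g s))
        = pr (integral\<^sup>L lborel f) (integral\<^sup>L lborel g)" .
qed

lemma bounded_bilinear_matrix_mult: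
  "bounded_bilinear ((**) :: real^'n^'m \<Rightarrow> real^'p^'n \<Rightarrow> real^'p^'m)"
proof -
  have "bilinear ((**) :: real^'n^'m \<Rightarrow> real^'p^'n \<Rightarrow> real^'p^'m)"
    unfolding bilinear_def linear_iff
    by (simp add: matrix_add_ldistrib matrix_matrix_mult_def vec_eq_iff
        sum.distrib sum_distrib_left algebra_simps)
  then show ?thesis
    by (rule bilinear_conv_bounded_bilinear[THEN iffD1])
qed

text \<open>
  Since \<open>exp (- l t) = exp (- l (t - s)) exp (- l s)\<close>, the weight splits over the two factors; the
  two half-line indicators together reproduce the integration range \<open>{0..t}\<close>, also for negative
  \<open>t\<close>, where both sides vanish. This makes \<^const>\<open>conv\<close> a convolution over the whole line.
\<close>

lemma conv_exp_weight:
  "exp (- l * t) *\<^sub>R conv f g t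
    = (LINT s|lborel. (exp (- l * (t - s)) *\<^sub>R indicator {0..} (t - s) *\<^sub>R f (t - s))
        ** (exp (- l * s) *\<^sub>R indicator {0..} s *\<^sub>R g s))"
proof -
  interpret bounded_bilinear "(**) :: real^'a^'a \<Rightarrow> real^'a^'a \<Rightarrow> real^'a^'a"
    by (rule bounded_bilinear_matrix_mult)
  have "exp (- l * t) *\<^sub>R conv f g t
      = (LINT s|lborel. exp (- l * t) *\<^sub>R indicator {0..t} s *\<^sub>R (f (t - s) ** g s))"
    unfolding conv_def set_lebesgue_integral_def by (subst integral_scaleR_right) auto
  also have "\<dots> = (LINT s|lborel. (exp (- l * (t - s)) *\<^sub>R indicator {0..} (t - s) *\<^sub>R f (t - s))
        ** (exp (- l * s) *\<^sub>R indicator {0..} s *\<^sub>R g s))"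
    by (intro Bochner_Integration.integral_cong refl)
      (auto simp: indicator_def scaleR_left scaleR_right zero_left zero_right
        exp_add[symmetric] algebra_simps)
  finally show ?thesis .
qed

lemma
  assumes "set_integrable lborel {0..} (\<lambda>t. exp (- l * t) *\<^sub>R f t)"
    and "set_integrable lborel {0..} (\<lambda>t. exp (- l * t) *\<^sub>R g t)"
  shows set_integrable_conv_exp: "set_integrable lborel {0..} (\<lambda>t. exp (- l * t) *\<^sub>R conv f g t)"
    and laplace_conv: "(LINT t:{0..}|lborel. exp (- l * t) *\<^sub>R conv f g t)
      = (LINT t:{0..}|lborel. exp (- l * t) *\<^sub>R f t) ** (LINT t:{0..}|lborel. exp (- l * t) *\<^sub>R g t)"
proof -
  have "indicator {0..} t *\<^sub>R exp (- l * t) *\<^sub>R conv f g t = exp (- l * t) *\<^sub>R conv f g t" for t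
    by (cases "t < 0") (simp_all add: conv_def set_lebesgue_integral_def)
  then have "(\<lambda>t. indicator {0..} t *\<^sub>R exp (- l * t) *\<^sub>R conv f g t)
      = (\<lambda>t. exp (- l * t) *\<^sub>R conv f g t)"
    by (rule ext)
  note eq = this[unfolded conv_exp_weight]
  have *: "integrable lborel (\<lambda>t. exp (- l * t) *\<^sub>R indicator {0..} t *\<^sub>R f t)"
     "integrable lborel (\<lambda>t. exp (- l * t) *\<^sub>R indicator {0..} t *\<^sub>R g t)"
    using assms by (simp_all add: set_integrable_def mult.commute)
  show "set_integrable lborel {0..} (\<lambda>t. exp (- l * t) *\<^sub>R conv f g t)"
    unfolding set_integrable_def conv_exp_weight eq
    by (rule integrable_convolution[OF bounded_bilinear_matrix_mult *])
  show "(LINT t:{0..}|lborel. exp (- l * t) *\<^sub>R conv f g t)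
      = (LINT t:{0..}|lborel. exp (- l * t) *\<^sub>R f t) ** (LINT t:{0..}|lborel. exp (- l * t) *\<^sub>R g t)"
    unfolding set_lebesgue_integral_def conv_exp_weight eq
    using integral_convolution[OF bounded_bilinear_matrix_mult *]
    by (simp add: mult.commute)
qed

section \<open>Laplace transforms of functions and the limit at zero\<close>

lemma set_integrable_exp_decay:
  assumes "0 < l"
  shows "set_integrable lborel {0..} (\<lambda>t::real. exp (- l * t))"
proof -
  have "(\<integral>\<^sup>+ t. ennreal (exp (- l * t)) * indicator {0..} t \<partial>lborel) = ennreal (0 - - exp (- l * 0) / l)"
  proof (rule nn_integral_FTC_atLeast)
    show "((\<lambda>t. - exp (- l * t) / l) has_real_derivative exp (- l * t)) (at t)" for t
      using assms by (auto intro!: derivative_eq_intros)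
    have "((\<lambda>t. exp (- (l * t))) \<longlongrightarrow> 0) at_top"
      using assms by (intro filterlim_compose[OF exp_at_bot] filterlim_compose[OF filterlim_uminus_at_bot_at_top]
          filterlim_tendsto_pos_mult_at_top[OF tendsto_const _ filterlim_ident])
    from tendsto_divide[OF tendsto_minus[OF this] tendsto_const, of l]
    show "((\<lambda>t. - exp (- l * t) / l) \<longlongrightarrow> 0) at_top"
      using assms by simp
  qed auto
  then have "integrable lborel (\<lambda>t. exp (- l * t) * indicator {0..} t)"
    by (intro integrableI_nonneg) (auto simp: ennreal_mult' ennreal_indicator)
  then show ?thesis
    by (simp add: set_integrable_def mult.commute)
qed

text \<open>
  Near 0 local square integrability controls \<open>k\<close>, because \<open>\<bar>k\<bar> \<le> 1 + k\<^sup>2\<close>; beyond 1 monotonicity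
  bounds \<open>k\<close> by \<open>k 1\<close>, and the exponential is integrable.
\<close>

lemma set_integrable_nonneg_antimono_exp:
  fixes k :: "real \<Rightarrow> real"
  assumes "0 < l" and L2: "L2_loc k"
    and nonneg: "\<And>t. 0 < t \<Longrightarrow> 0 \<le> k t" and anti: "antimono_on {0<..} k"
  shows "set_integrable lborel {0..} (\<lambda>t. exp (- l * t) * k t)"
proof -
  have meas: "(\<lambda>t. indicator {0..} t * k t) \<in> borel_measurable lborel"
    using L2 by (simp add: L2_loc_def set_borel_measurable_def)
  have sq: "integrable lborel (\<lambda>t. indicator {0..1} t * (k t)\<^sup>2)"
    using L2 by (auto simp: L2_loc_def set_integrable_def)
  have "integrable lborel (\<lambda>t. indicator {0..1} t * 1 + indicator {0..1} t * (k t)\<^sup>2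
      + \<bar>k 1\<bar> * (indicator {0..} t * exp (- l * t)))" (is "integrable _ ?B")
    using sq set_integrable_exp_decay[OF \<open>0 < l\<close>]
    by (intro Bochner_Integration.integrable_add integrable_mult_right) (auto simp: set_integrable_def)
  then have "integrable lborel (\<lambda>t. exp (- l * t) * (indicator {0..} t * k t))"
  proof (rule Bochner_Integration.integrable_bound)
    have "norm (exp (- l * t) * (indicator {0..} t * k t)) \<le> norm (?B t)" for t
    proof -
      consider "t < 0" | "0 \<le> t" "t \<le> 1" | "1 < t" by linarith
      then show ?thesis
      proof cases
        case 1 then show ?thesis by simp
      next
        case 2
        have "\<bar>k t\<bar> * 2 \<le> 1 + (k t)\<^sup>2"
          using zero_le_power2[of "\<bar>k t\<bar> - 1"] by (simp add: power2_diff)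
        then have "\<bar>k t\<bar> \<le> 1 + (k t)\<^sup>2" by linarith
        moreover have "exp (- l * t) * \<bar>k t\<bar> \<le> 1 * \<bar>k t\<bar>"
          using 2 \<open>0 < l\<close> by (intro mult_right_mono) auto
        ultimately have "exp (- l * t) * \<bar>k t\<bar> \<le> 1 + (k t)\<^sup>2 + \<bar>k 1\<bar> * exp (- l * t)"
          by (simp add: add_increasing2)
        then show ?thesis using 2 by (simp add: abs_mult)
      next
        case 3
        then have "k t \<le> k 1" "0 \<le> k t"
          using anti nonneg by (auto simp: monotone_on_def)
        then show ?thesis using 3 by (simp add: abs_mult mult.commute mult_right_mono)
      qed
    qed
    then show "AE t in lborel. norm (exp (- l * t) * (indicator {0..} t * k t)) \<le> norm (?B t)"
      by simp
  qed (use meas in measurable)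
  then show ?thesis by (simp add: set_integrable_def mult_ac)
qed

text \<open>
  Identities that hold only almost everywhere do not transfer Borel measurability, so the
  resolvent must obtain it on the half-line from its restrictions to bounded intervals.
\<close>

lemma set_borel_measurable_L1_loc:
  assumes "L1_loc f"
  shows "set_borel_measurable lborel {0..} f"
  unfolding set_borel_measurable_def
proof (rule borel_measurable_LIMSEQ_metric)
  show "(\<lambda>t. indicator {0..real n} t *\<^sub>R f t) \<in> borel_measurable lborel" for n
    using assms unfolding L1_loc_def set_integrable_def by (blast intro: borel_measurable_integrable)
  show "(\<lambda>n. indicator {0..real n} t *\<^sub>R f t) \<longlonglongrightarrow> indicator {0..} t *\<^sub>R f t" for t
  proof (rule tendsto_eventually)
    show "\<forall>\<^sub>F n in sequentially. indicator {0..real n} t *\<^sub>R f t = indicator {0..} t *\<^sub>R f t"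
      using eventually_ge_at_top[of "nat \<lceil>t\<rceil>"]
      by eventually_elim (auto simp: indicator_def of_nat_ceiling intro: order_trans)
  qed
qed

text \<open>
  The transform is sampled along the exponents \<open>1 / (n + 1)\<close>, which decrease to 0, so that the
  convergence theorems for sequences apply.
\<close>

lemma laplace_tendsto_integral:
  fixes f :: "real \<Rightarrow> 'a::{banach, second_countable_topology}"
  assumes "set_integrable lborel {0..} f"
  shows "(\<lambda>n. LINT t:{0..}|lborel. exp (- (1 / real (Suc n)) * t) *\<^sub>R f t)
    \<longlonglongrightarrow> (LINT t:{0..}|lborel. f t)"
  unfolding set_lebesgue_integral_def
proof (rule integral_dominated_convergence[where w = "\<lambda>t. norm (indicator {0..} t *\<^sub>R f t)"])
  have [measurable]: "(\<lambda>t. indicator {0..} t *\<^sub>R f t) \<in> borel_measurable lborel"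
    using assms by (auto simp: set_integrable_def)
  then show "(\<lambda>t. indicator {0..} t *\<^sub>R f t) \<in> borel_measurable lborel" .
  have "(\<lambda>t. exp (- (1 / real (Suc n)) * t) *\<^sub>R indicator {0..} t *\<^sub>R f t) \<in> borel_measurable lborel" for n
    by measurable
  then show "(\<lambda>t. indicator {0..} t *\<^sub>R exp (- (1 / real (Suc n)) * t) *\<^sub>R f t) \<in> borel_measurable lborel" for n
    by (simp add: mult.commute)
  show "integrable lborel (\<lambda>t. norm (indicator {0..} t *\<^sub>R f t))"
    using assms unfolding set_integrable_def by (rule integrable_norm)
  have "(\<lambda>n. exp (- (1 / real (Suc n)) * t)) \<longlonglongrightarrow> exp (- 0 * t)" for t
    by (intro tendsto_intros LIMSEQ_Suc[OF lim_1_over_n])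
  then have "(\<lambda>n. indicator {0..} t *\<^sub>R exp (- (1 / real (Suc n)) * t) *\<^sub>R f t)
      \<longlonglongrightarrow> indicator {0..} t *\<^sub>R exp (- 0 * t) *\<^sub>R f t" for t
    by (intro tendsto_scaleR tendsto_const)
  then show "AE t in lborel. (\<lambda>n. indicator {0..} t *\<^sub>R exp (- (1 / real (Suc n)) * t) *\<^sub>R f t)
      \<longlonglongrightarrow> indicator {0..} t *\<^sub>R f t"
    by simp
  show "AE t in lborel. norm (indicator {0..} t *\<^sub>R exp (- (1 / real (Suc n)) * t) *\<^sub>R f t)
      \<le> norm (indicator {0..} t *\<^sub>R f t)" for n
    by (rule AE_I2) (auto simp: indicator_def intro!: mult_left_le_one_le)
qed

text \<open>
  The weights increase to 1 along this sequence, so for a nonnegative \<open>k\<close> this is monotone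
  convergence.
\<close>

lemma set_integrable_of_laplace_convergent:
  fixes k :: "real \<Rightarrow> real"
  assumes "set_borel_measurable lborel {0..} k" and nonneg: "\<And>t. 0 < t \<Longrightarrow> 0 \<le> k t"
    and int: "\<And>n. set_integrable lborel {0..} (\<lambda>t. exp (- (1 / real (Suc n)) * t) * k t)"
    and conv: "(\<lambda>n. LINT t:{0..}|lborel. exp (- (1 / real (Suc n)) * t) * k t) \<longlonglongrightarrow> x"
  shows "set_integrable lborel {0..} k"
  unfolding set_integrable_def
proof (rule integrable_monotone_convergence)
  show "integrable lborel (\<lambda>t. indicator {0..} t *\<^sub>R (exp (- (1 / real (Suc n)) * t) * k t))" for n
    using int by (simp add: set_integrable_def)
  show "AE t in lborel. mono (\<lambda>n. indicator {0..} t *\<^sub>R (exp (- (1 / real (Suc n)) * t) * k t))"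
    using AE_lborel_singleton[of 0]
  proof eventually_elim
    case (elim t)
    show ?case
    proof (cases "0 < t")
      case True
      then show ?thesis
        using nonneg[of t]
        by (auto intro!: monoI mult_right_mono divide_left_mono simp: divide_simps)
    next
      case False
      then show ?thesis using elim by (auto simp: mono_def)
    qed
  qed
  have "(\<lambda>n. exp (- (1 / real (Suc n)) * t)) \<longlonglongrightarrow> exp (- 0 * t)" for t
    by (intro tendsto_intros LIMSEQ_Suc[OF lim_1_over_n])
  then have "(\<lambda>n. indicator {0..} t *\<^sub>R (exp (- (1 / real (Suc n)) * t) * k t))
      \<longlonglongrightarrow> indicator {0..} t *\<^sub>R (exp (- 0 * t) * k t)" for t
    by (intro tendsto_scaleR tendsto_mult tendsto_const)
  then show "AE t in lborel. (\<lambda>n. indicator {0..} t *\<^sub>R (exp (- (1 / real (Suc n)) * t) * k t))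
      \<longlonglongrightarrow> indicator {0..} t *\<^sub>R k t"
    by simp
qed (use assms in \<open>auto simp: set_lebesgue_integral_def set_borel_measurable_def\<close>)

lemma set_integrable_exp_scaleR:
  fixes f :: "real \<Rightarrow> 'a::{banach, second_countable_topology}"
  assumes "set_integrable lborel {0..} f" and "0 \<le> l"
  shows "set_integrable lborel {0..} (\<lambda>t. exp (- l * t) *\<^sub>R f t)"
proof -
  have [measurable]: "(\<lambda>t. indicator {0..} t *\<^sub>R f t) \<in> borel_measurable lborel"
    using assms by (auto simp: set_integrable_def)
  have "integrable lborel (\<lambda>t. exp (- l * t) *\<^sub>R indicator {0..} t *\<^sub>R f t)"
    using assms(1) unfolding set_integrable_def
  proof (rule Bochner_Integration.integrable_bound)
    show "AE t in lborel. norm (exp (- l * t) *\<^sub>R indicator {0..} t *\<^sub>R f t)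
        \<le> norm (indicator {0..} t *\<^sub>R f t)"
      using assms(2) by (intro AE_I2) (auto simp: indicator_def intro!: mult_left_le_one_le)
  qed measurable
  then show ?thesis
    by (simp add: set_integrable_def mult.commute)
qed

section \<open>The resolvent and the kernel\<close>

lemma invertible_of_gram_eigenvalues_pos:
  fixes \<beta> :: "real^'m^'m"
  assumes "\<And>l. eigenvalue (transpose \<beta> ** \<beta>) l \<Longrightarrow> 0 < l"
  shows "invertible \<beta>"
proof -
  have "v = 0" if "\<beta> *v v = 0" for v
  proof (rule ccontr)
    assume "v \<noteq> 0"
    with that have "eigenvalue (transpose \<beta> ** \<beta>) 0"
      by (auto simp: eigenvalue_def matrix_vector_mul_assoc[symmetric] intro!: exI[of _ v])
    from assms[OF this] show False by simp
  qed
  then have "\<exists>B. B ** \<beta> = mat 1"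
    by (simp add: matrix_left_invertible_ker)
  then show ?thesis
    by (simp add: invertible_left_inverse)
qed

text \<open>
  In this form integrals of the matrix-valued kernel reduce, by linearity, to integrals of its
  scalar entries.
\<close>

lemma diag_kernel_eq_sum: "diag_kernel (K :: 'a::finite \<Rightarrow> _) t = (\<Sum>i\<in>UNIV. K i t *\<^sub>R axis i (axis i 1))"
proof -
  have "(K i t *\<^sub>R axis i (axis i 1 :: real^'a)) $ a $ b = (if i = a then if a = b then K a t else 0 else 0)"
    for i a b
    by (auto simp: axis_def)
  then show ?thesis
    by (simp add: diag_kernel_def vec_eq_iff)
qed

lemma set_integrable_Min:
  fixes k :: "'m::finite \<Rightarrow> real \<Rightarrow> real"
  assumes meas: "\<And>j. set_borel_measurable lborel {0..} (k j)"
    and nonneg: "\<And>j t. 0 < t \<Longrightarrow> 0 \<le> k j t"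
    and int: "set_integrable lborel {0..} (k i)"
  shows "set_integrable lborel {0..} (\<lambda>t. MIN j. k j t)"
proof -
  have eq: "indicator {0..} t *\<^sub>R (MIN j. k j t) = (MIN j. indicator {0..} t * k j t)" for t :: real
    by (auto simp: indicator_def)
  show ?thesis
    using int unfolding set_integrable_def
  proof (rule Bochner_Integration.integrable_bound)
    show "(\<lambda>t. indicator {0..} t *\<^sub>R (MIN j. k j t)) \<in> borel_measurable lborel"
      unfolding eq using meas by (intro borel_measurable_Min) (auto simp: set_borel_measurable_def)
    show "AE t in lborel. norm (indicator {0..} t *\<^sub>R (MIN j. k j t)) \<le> norm (indicator {0..} t *\<^sub>R k i t)"
      using AE_lborel_singleton[of 0]
    proof eventually_elim
      case (elim t)
      then consider "t < 0" | "0 < t" by linarith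
      then show ?case
      proof cases
        case 2
        have "0 \<le> (MIN j. k j t)" using nonneg[OF 2] by simp
        moreover have "(MIN j. k j t) \<le> k i t" by (intro Min_le) auto
        ultimately show ?thesis using 2 by simp
      qed simp
    qed
  qed
qed

text \<open>
  Multiplying \<open>E\<^sub>\<beta> = K - R * K\<close> by \<open>- \<beta>\<close> from the right gives \<open>K\<^sub>\<beta> - R * K\<^sub>\<beta>\<close>, which is \<open>R\<close> by
  the resolvent equation. As multiplication by \<open>\<beta>\<close> has an inverse, it commutes with the convolution
  integral even at points \<open>t\<close> where that integral fails to exist.
\<close>

lemma E_beta_mult_eq_R_beta:
  fixes \<beta> :: "real^'m^'m"
  assumes R: "is_R_beta K \<beta> R" and inv: "invertible \<beta>"
  shows "AE t in lborel. 0 \<le> t \<longrightarrow> R t = - (E_beta K R t ** \<beta>)"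
proof -
  interpret bounded_bilinear "(**) :: real^'m^'m \<Rightarrow> real^'m^'m \<Rightarrow> real^'m^'m"
    by (rule bounded_bilinear_matrix_mult)
  obtain B where B: "\<beta> ** B = mat 1"
    using inv by (auto simp: invertible_def)
  have "conv R (K_beta K \<beta>) t = - (conv R (diag_kernel K) t ** \<beta>)" for t
  proof -
    have "indicator {0..t} s *\<^sub>R (R (t - s) ** K_beta K \<beta> s)
        = - ((indicator {0..t} s *\<^sub>R (R (t - s) ** diag_kernel K s)) ** \<beta>)" for s
      by (simp add: K_beta_def minus_right scaleR_left matrix_mul_assoc)
    moreover have "(LINT s|lborel. - ((indicator {0..t} s *\<^sub>R (R (t - s) ** diag_kernel K s)) ** \<beta>))
      = - ((LINT s|lborel. indicator {0..t} s *\<^sub>R (R (t - s) ** diag_kernel K s)) ** \<beta>)"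
      by (rule integral_bounded_linear'[where T' = "\<lambda>X. - (X ** B)"])
        (auto intro!: bounded_linear_minus bounded_linear_left
          simp: minus_left matrix_mul_assoc[symmetric] B)
    ultimately show ?thesis
      by (simp add: conv_def set_lebesgue_integral_def)
  qed
  with R show ?thesis
    unfolding is_R_beta_def by (auto simp: E_beta_def K_beta_def diff_left algebra_simps)
qed

text \<open>
  Were \<open>K \<beta>\<close> integrable, integrating the resolvent equation \<open>R * K\<^sub>\<beta> = K\<^sub>\<beta> - R\<close> would give
  \<open>I = 0\<close>.
\<close>

lemma K_beta_not_integrable:
  fixes \<beta> :: "real^'m^'m"
  assumes R: "is_R_beta K \<beta> R" and I: "(LINT t:{0..}|lborel. R t) = mat 1"
  shows "\<not> set_integrable lborel {0..} (\<lambda>t. diag_kernel K t ** \<beta>)"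
proof
  assume "set_integrable lborel {0..} (\<lambda>t. diag_kernel K t ** \<beta>)"
  then have intK: "set_integrable lborel {0..} (K_beta K \<beta>)"
    by (simp add: set_integrable_def K_beta_def)
  have mat1: "mat 1 \<noteq> (0 :: real^'m^'m)"
    by (simp add: vec_eq_iff mat_def)
  (* Otherwise the integral of R would have the default value 0. *)
  have intR: "set_integrable lborel {0..} R"
    using I mat1 not_integrable_integral_eq
    unfolding set_integrable_def set_lebesgue_integral_def by fastforce
  note c = set_integrable_conv_exp[of 0 R "K_beta K \<beta>"] laplace_conv[of 0 R "K_beta K \<beta>"]
  have "(LINT t:{0..}|lborel. conv R (K_beta K \<beta>) t) = (LINT t:{0..}|lborel. K_beta K \<beta> t - R t)"
    unfolding set_lebesgue_integral_def
  proof (rule integral_cong_AE)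
    show "AE t in lborel. indicator {0..} t *\<^sub>R conv R (K_beta K \<beta>) t
        = indicator {0..} t *\<^sub>R (K_beta K \<beta> t - R t)"
      using R unfolding is_R_beta_def by (auto simp: indicator_def)
    show "(\<lambda>t. indicator {0..} t *\<^sub>R conv R (K_beta K \<beta>) t) \<in> borel_measurable lborel"
      using c(1) intR intK by (auto simp: set_integrable_def)
    show "(\<lambda>t. indicator {0..} t *\<^sub>R (K_beta K \<beta> t - R t)) \<in> borel_measurable lborel"
      using set_integral_diff(1)[OF intK intR] by (auto simp: set_integrable_def)
  qed
  also have "\<dots> = (LINT t:{0..}|lborel. K_beta K \<beta> t) - mat 1"
    using set_integral_diff(2)[OF intK intR] I by simp
  finally show False
    using c(2) intR intK I mat1 by simp
qed

text \<open>
  Passing to the limit in \<open>L E = (I - L R) (L K)\<close>: as \<open>L K\<close> is diagonal, a nonzero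
  entry of \<open>I - \<integral> R\<close> in column \<open>j\<close> would force \<open>L K\<^sub>j\<close> to stay finite at exponent 0, against
  the non-integrability of \<open>K\<^sub>j\<close>.
\<close>

lemma integral_R_beta_eq_mat_1:
  fixes K :: "'m::finite \<Rightarrow> real \<Rightarrow> real"
  assumes R: "is_R_beta K \<beta> R" and E: "set_integrable lborel {0..} (E_beta K R)"
    and inv: "invertible \<beta>"
    and L2: "\<And>i. L2_loc (K i)" and nonneg: "\<And>i t. 0 < t \<Longrightarrow> 0 \<le> K i t"
    and anti: "\<And>i. antimono_on {0<..} (K i)"
    and nonint: "\<And>i. \<not> set_integrable lborel {0..} (K i)"
  shows "(LINT t:{0..}|lborel. R t) = mat 1"
proof -
  interpret bounded_bilinear "(**) :: real^'m^'m \<Rightarrow> real^'m^'m \<Rightarrow> real^'m^'m"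
    by (rule bounded_bilinear_matrix_mult)
  have intR: "set_integrable lborel {0..} R"
  proof -
    have "integrable lborel (\<lambda>t. - ((indicator {0..} t *\<^sub>R E_beta K R t) ** \<beta>))"
      using E unfolding set_integrable_def
      by (intro Bochner_Integration.integrable_minus integrable_bounded_linear[OF bounded_linear_left])
    then show ?thesis
      unfolding set_integrable_def
    proof (rule integrable_cong_AE_imp)
      show "(\<lambda>t. indicator {0..} t *\<^sub>R R t) \<in> borel_measurable lborel"
        using set_borel_measurable_L1_loc R by (auto simp: is_R_beta_def set_borel_measurable_def)
      show "AE t in lborel. - ((indicator {0..} t *\<^sub>R E_beta K R t) ** \<beta>) = indicator {0..} t *\<^sub>R R t"
        using E_beta_mult_eq_R_beta[OF R inv]
        by eventually_elim (auto simp: indicator_def zero_left)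
    qed
  qed
  define L where "L n f = (LINT t:{0..}|lborel. exp (- (1 / real (Suc n)) * t) *\<^sub>R f t)"
    for n and f :: "real \<Rightarrow> real^'m^'m"
  define k where "k n i = (LINT t:{0..}|lborel. exp (- (1 / real (Suc n)) * t) * K i t)" for n i
  have intk: "set_integrable lborel {0..} (\<lambda>t. exp (- (1 / real (Suc n)) * t) * K i t)" for n i
    by (rule set_integrable_nonneg_antimono_exp[OF _ L2 nonneg anti]) auto
  have *: "indicator {0..} t *\<^sub>R exp (- (1 / real (Suc n)) * t) *\<^sub>R diag_kernel K t
      = (\<Sum>i\<in>UNIV. (indicator {0..} t *\<^sub>R (exp (- (1 / real (Suc n)) * t) * K i t)) *\<^sub>R axis i (axis i 1))" for n t
    by (simp add: diag_kernel_eq_sum scaleR_sum_right)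
  have intD: "set_integrable lborel {0..} (\<lambda>t. exp (- (1 / real (Suc n)) * t) *\<^sub>R diag_kernel K t)" for n
    using intk unfolding set_integrable_def *
    by (intro Bochner_Integration.integrable_sum integrable_scaleR_left)
  (* The transform of the kernel does not depend on time; it is written as a diagonal kernel that is
     constant in time and evaluated at the arbitrary point 0. *)
  have LD: "L n (diag_kernel K) = diag_kernel (\<lambda>i _. k n i) 0" for n
    using intk
    unfolding L_def k_def set_lebesgue_integral_def set_integrable_def *
      diag_kernel_eq_sum[of "\<lambda>i _. _ i"]
    by (subst Bochner_Integration.integral_sum)
      (auto intro!: sum.cong integral_scaleR_left integrable_scaleR_left simp del: scaleR_scaleR)
  have LE: "L n (E_beta K R) = (mat 1 - L n R) ** diag_kernel (\<lambda>i _. k n i) 0" for n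
  proof -
    have iR: "set_integrable lborel {0..} (\<lambda>t. exp (- (1 / real (Suc n)) * t) *\<^sub>R R t)"
      by (rule set_integrable_exp_scaleR[OF intR]) simp
    have "L n (E_beta K R) = L n (diag_kernel K) - L n (conv R (diag_kernel K))"
      unfolding L_def E_beta_def scaleR_diff_right
      by (rule set_integral_diff(2)[OF intD set_integrable_conv_exp[OF iR intD]])
    also have "L n (conv R (diag_kernel K)) = L n R ** L n (diag_kernel K)"
      unfolding L_def by (rule laplace_conv[OF iR intD])
    finally show ?thesis
      by (simp add: LD diff_left)
  qed
  have "(mat 1 - (LINT t:{0..}|lborel. R t)) $ i $ j = 0" for i j
  proof (rule ccontr)
    let ?a = "\<lambda>n. (mat 1 - L n R) $ i $ j"
    assume nz: "(mat 1 - (LINT t:{0..}|lborel. R t)) $ i $ j \<noteq> 0"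
    have lim_a: "?a \<longlonglongrightarrow> (mat 1 - (LINT t:{0..}|lborel. R t)) $ i $ j"
      unfolding L_def by (intro tendsto_intros laplace_tendsto_integral intR)
    have "L n (E_beta K R) $ i $ j = ?a n * k n j" for n
      unfolding LE
      by (simp add: matrix_matrix_mult_def diag_kernel_def if_distrib[where f="\<lambda>x. _ * x"] cong: if_cong)
    moreover have "(\<lambda>n. L n (E_beta K R) $ i $ j) \<longlonglongrightarrow> (LINT t:{0..}|lborel. E_beta K R t) $ i $ j"
      unfolding L_def by (intro tendsto_intros laplace_tendsto_integral E)
    ultimately have "(\<lambda>n. (?a n * k n j) / ?a n) \<longlonglongrightarrow>
        (LINT t:{0..}|lborel. E_beta K R t) $ i $ j / (mat 1 - (LINT t:{0..}|lborel. R t)) $ i $ j"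
      using nz lim_a by (intro tendsto_divide) simp_all
    moreover have "\<forall>\<^sub>F n in sequentially. (?a n * k n j) / ?a n = k n j"
      using tendsto_imp_eventually_ne[OF lim_a nz] by eventually_elim simp
    ultimately have "(\<lambda>n. k n j) \<longlonglongrightarrow>
        (LINT t:{0..}|lborel. E_beta K R t) $ i $ j / (mat 1 - (LINT t:{0..}|lborel. R t)) $ i $ j"
      by (rule Lim_transform_eventually)
    note lim_k = this[unfolded k_def]
    have "set_borel_measurable lborel {0..} (K j)"
      using L2[of j] by (simp add: L2_loc_def)
    from set_integrable_of_laplace_convergent[OF this nonneg intk lim_k]
    have "set_integrable lborel {0..} (K j)" .
    with nonint show False by blast
  qed
  then show ?thesis
    by (simp add: vec_eq_iff)
qed

theorem theorem5p7:
  fixes b \<sigma> :: "real^'m" and \<beta> :: "real^'m^'m"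
    and K :: "'m::finite \<Rightarrow> real \<Rightarrow> real"
    and R :: "real \<Rightarrow> real^'m^'m"
  assumes "admissible b \<beta> \<sigma> K"
    and "is_R_beta K \<beta> R"
    and "set_integrable lborel {0..} (E_beta K R)"
  shows "((LINT t:{0..}|lborel. R t) = mat 1 \<longrightarrow>
            \<not> set_integrable lborel {0..} (\<lambda>t. diag_kernel K t ** \<beta>))
       \<and> ((\<forall>l. eigenvalue (transpose \<beta> ** \<beta>) l \<longrightarrow> 0 < l) \<and>
          \<not> set_integrable lborel {0..} (\<lambda>t. MIN j. K j t) \<longrightarrow>
            (LINT t:{0..}|lborel. R t) = mat 1)"
proof (intro conjI impI)
  assume "(LINT t:{0..}|lborel. R t) = mat 1"
  then show "\<not> set_integrable lborel {0..} (\<lambda>t. diag_kernel K t ** \<beta>)"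
    by (rule K_beta_not_integrable[OF assms(2)])
next
  assume b: "(\<forall>l. eigenvalue (transpose \<beta> ** \<beta>) l \<longrightarrow> 0 < l) \<and>
          \<not> set_integrable lborel {0..} (\<lambda>t. MIN j. K j t)"
  have L2: "\<And>i. L2_loc (K i)"
    using assms(1) by (simp add: admissible_def)
  have reg: "\<forall>i. \<forall>h\<in>{0..1}. regular_kernel (\<lambda>t. K i (t + h))"
    using assms(1) unfolding admissible_def by (elim conjE)
  (* The unshifted kernel is the case of shift 0. *)
  have "regular_kernel (\<lambda>t. K i (t + 0))" for i
    by (rule reg[THEN spec, THEN bspec]) simp
  then have nonneg: "\<And>i t. 0 < t \<Longrightarrow> 0 \<le> K i t" and anti: "\<And>i. antimono_on {0<..} (K i)"
    by (simp_all add: regular_kernel_def)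
  show "(LINT t:{0..}|lborel. R t) = mat 1"
  proof (rule integral_R_beta_eq_mat_1[OF assms(2,3) _ L2 nonneg anti])
    show "invertible \<beta>"
      using b invertible_of_gram_eigenvalues_pos by blast
    show "\<not> set_integrable lborel {0..} (K i)" for i
    proof
      assume "set_integrable lborel {0..} (K i)"
      then have "set_integrable lborel {0..} (\<lambda>t. MIN j. K j t)"
        using L2 nonneg by (intro set_integrable_Min) (simp_all add: L2_loc_def)
      with b show False by blast
    qed
  qed
qed

end
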